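(* Suppose $K=0$. For any $b,h\in[0,1]$, $L\in\mathbb{Z}_{\ge 0}$, $U>0$, $T\in\mathbb{Z}_{>0}$, and $\gamma\in(0,1]$, with the class of non-stationary base-stock policies $\Pi_{(S^t)}=[0,H]^{T+L}$ bounded by $H=(L+1)U$, one has $$\mathrm{P}_\gamma\text{-}\mathrm{dim}\big(\mathcal{Y}^t(\Pi_{(S^t)})\big)\le \frac{2}{\gamma}+1\qquad\text{for all } t=L+1,\dots,T+L,$$ where $\mathcal{Y}^t(\Pi_{(S^t)})=\Big\{\mathbf{d}\mapsto \frac{y^t((S^{t'})_{t'=1}^{t-L},\mathbf{d})}{(L+1)U}:(S^{t'})_{t'=1}^{t-L}\in[0,H]^{t-L}\Big\}$ is the class of normalized period-$t$ inventory levels (after replenishment, before demand), as functions on $[0,U]^{T+L}$.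
   Context: Inventory model (backlogged demand, lead time $L$). There are $T+L$ periods; a demand sequence is $\mathbf{d}=(d^1,\dots,d^{T+L})\in[0,U]^{T+L}$. Let $x^t$ be the inventory level at the beginning of period $t$ and $q^t\ge 0$ the quantity ordered in period $t$ (arriving in period $t+L$), with $q^t=0$ for $t\le 0$. The inventory position before ordering is $I^t=x^t+\sum_{t'=t-L}^{t-1}q^{t'}$. After replenishment (but before demand) the inventory level is $y^t=x^t+q^{t-L}$, and $x^{t+1}=y^t-d^t$. The initial level $x^1\le 0$ is a fixed constant. Here $h,b$ are per-unit holding and backlogging costs and $K$ is the fixed ordering cost; they do not enter the dynamics. Non-stationary base-stock policies: a policy $(S^t)_{t=1}^{T+L}\in[0,H]^{T+L}$ orders $q^t=\max\{S^t-I^t,0\}$ in period $t$. For $t\ge L+1$ the level $y^t$ depends only on $(S^{t'})_{t'=1}^{t-L}$ and $\mathbf{d}$, and equals $$y^t\big((S^{t'})_{t'=1}^{t-L},\mathbf{d}\big)=\max_{\hat t=1,\dots,t-L}\Big\{S^{\hat t}-\sum_{t'=\hat t}^{t-L-1}d^{t'}\Big\}-\sum_{t'=t-L}^{t-1}d^{t'}.$$ Pseudo$_\gamma$-dimension: a dataset $(\mathbf{d}_i)_{i=1}^m$ in $[0,U]^{T+L}$ is $\gamma$-shattered by a class $\{f(\pi,\cdot):\pi\in\Pi\}$ of real-valued functions if there exist $\tau_1,\dots,\tau_m\in\mathbb{R}$ such that for every $A\subseteq\{1,\dots,m\}$ there is $\pi\in\Pi$ with $f(\pi,\mathbf{d}_i)>\tau_i+\gamma$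 for all $i\in A$ and $f(\pi,\mathbf{d}_i)\le\tau_i-\gamma$ for all $i\notin A$. $\mathrm{P}_\gamma\text{-}\mathrm{dim}$ is the maximum size of a dataset that can be $\gamma$-shattered. *)

theory Defs
  imports Complex_Main "HOL-Library.FuncSet" "HOL-Library.Extended_Real"
begin

text \<open>
  Backlogged inventory dynamics under the base-stock policy \<open>S\<close>, with lead time \<open>L\<close>, initial
  level \<open>x\<^sub>1\<close> and demands \<open>d\<close>. Periods are numbered from 1. Since \<open>order_qty\<close> is 0 in
  period 0, truncated subtraction in \<open>t - L\<close> expresses exactly that nothing was ordered
  in periods \<open>\<le> 0\<close>. The values of the other three functions at \<open>t = 0\<close> are never used for \<open>t \<ge> 1\<close>.
\<close>

function inv_level inv_pos order_qty stock_level ::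
  "nat \<Rightarrow> real \<Rightarrow> (nat \<Rightarrow> real) \<Rightarrow> (nat \<Rightarrow> real) \<Rightarrow> nat \<Rightarrow> real"
where
  "inv_level L x\<^sub>1 S d t =
     (if t \<le> 1 then x\<^sub>1 else stock_level L x\<^sub>1 S d (t - 1) - d (t - 1))"
| "inv_pos L x\<^sub>1 S d t =
     inv_level L x\<^sub>1 S d t + (\<Sum>t'\<in>{t - L..<t}. order_qty L x\<^sub>1 S d t')"
| "order_qty L x\<^sub>1 S d t =
     (if t = 0 then 0 else max (S t - inv_pos L x\<^sub>1 S d t) 0)"
| "stock_level L x\<^sub>1 S d t =
     inv_level L x\<^sub>1 S d t + order_qty L x\<^sub>1 S d (t - L)"
  by pat_completeness auto
termination
  by (relation "measure (\<lambda>a. case a of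
        Inl (Inl (L, x\<^sub>1, S, d, t)) \<Rightarrow> 4 * t
      | Inl (Inr (L, x\<^sub>1, S, d, t)) \<Rightarrow> 4 * t + 1
      | Inr (Inl (L, x\<^sub>1, S, d, t)) \<Rightarrow> 4 * t + 2
      | Inr (Inr (L, x\<^sub>1, S, d, t)) \<Rightarrow> 4 * t + 3)") auto

declare inv_level.simps [simp del] inv_pos.simps [simp del]
  order_qty.simps [simp del] stock_level.simps [simp del]

text \<open>
  The level \<open>stock_level L x\<^sub>1 S d t\<close> only reads \<open>S\<close> on \<open>{1..t - L}\<close> (and \<open>d\<close> on \<open>{1..t - 1}\<close>),
  so that a partial policy on these periods determines it.
\<close>

definition stock_class ::
  "nat \<Rightarrow> real \<Rightarrow> real \<Rightarrow> real \<Rightarrow> nat \<Rightarrow> ((nat \<Rightarrow> real) \<Rightarrow> real) set"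
where
  "stock_class L x\<^sub>1 U H t =
     {(\<lambda>d. stock_level L x\<^sub>1 S d t / ((real L + 1) * U)) | S. S \<in> {1..t - L} \<rightarrow>\<^sub>E {0..H}}"

definition gamma_shattered ::
  "real \<Rightarrow> ('x \<Rightarrow> real) set \<Rightarrow> nat \<Rightarrow> (nat \<Rightarrow> 'x) \<Rightarrow> bool"
where
  "gamma_shattered \<gamma> F m x \<longleftrightarrow>
     (\<exists>\<tau> :: nat \<Rightarrow> real. \<forall>A \<subseteq> {1..m}. \<exists>f\<in>F.
        (\<forall>i\<in>A. f (x i) > \<tau> i + \<gamma>) \<and> (\<forall>i\<in>{1..m} - A. f (x i) \<le> \<tau> i - \<gamma>))"

text \<open>The value is \<open>\<infinity>\<close> if arbitrarily large datasets in \<open>X\<close> can be shattered.\<close>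

definition pseudo_gamma_dim :: "real \<Rightarrow> 'x set \<Rightarrow> ('x \<Rightarrow> real) set \<Rightarrow> enat"
where
  "pseudo_gamma_dim \<gamma> X F =
     Sup {enat m | m. \<exists>x. (\<forall>i\<in>{1..m}. x i \<in> X) \<and> gamma_shattered \<gamma> F m x}"

end

theory Submission
  imports Defs
begin

text \<open>
  Up to the demand during the lead time, the stock level in period \<open>n + L\<close> is the maximum over
  \<open>k \<le> n\<close> of \<open>S k - (\<Sum>j\<in>{k..<n}. d j)\<close>. Absorb the lead-time demand into the thresholds and let
  \<open>\<phi> i k\<close> be the \<open>i\<close>-th threshold plus \<open>\<Sum>j\<in>{k..<n}. d\<^sub>i j\<close>, which is nonincreasing in \<open>k\<close>. A policy
  for which exactly the \<open>i\<close>-th demand sequence is above its threshold yields a period \<open>k\<^sub>i\<close> with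
  \<open>\<phi> i k\<^sub>i + 2\<gamma>H < \<phi> j k\<^sub>i\<close> for all \<open>j \<noteq> i\<close>. By monotonicity in \<open>k\<close>, the values \<open>\<phi> i k\<^sub>i\<close> are pairwise
  more than \<open>2\<gamma>H\<close> apart; all of them lie in \<open>[0, H]\<close>, so there are at most \<open>1/(2\<gamma>) + 1\<close>.
\<close>

lemma order_qty_0 [simp]: "order_qty L x\<^sub>1 S d 0 = 0"
  by (simp add: order_qty.simps)

lemma inv_level_Suc:
  assumes "n \<ge> 1"
  shows "inv_level L x\<^sub>1 S d (Suc n)
    = inv_level L x\<^sub>1 S d n + order_qty L x\<^sub>1 S d (n - L) - d n"
  using assms by (subst inv_level.simps) (simp add: stock_level.simps)

lemma inv_pos_1: "inv_pos L x\<^sub>1 S d 1 = x\<^sub>1"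
proof -
  have "(\<Sum>t'\<in>{1 - L..<1}. order_qty L x\<^sub>1 S d t') = 0"
    by (rule sum.neutral) auto
  then show ?thesis
    by (simp add: inv_pos.simps inv_level.simps)
qed

text \<open>The order leaving the window of outstanding orders is the one that joins the on-hand
  level, so the position changes only by the new order and the demand.\<close>

lemma inv_pos_Suc:
  assumes "n \<ge> 1"
  shows "inv_pos L x\<^sub>1 S d (Suc n) = max (S n) (inv_pos L x\<^sub>1 S d n) - d n"
proof -
  let ?q = "order_qty L x\<^sub>1 S d"
  \<comment> \<open>For \<open>n < L\<close> both lower ends truncate to 0, and
    \<open>?q 0 = 0\<close> makes the identity survive.\<close>
  have "sum ?q {Suc n - L..<Suc n} + ?q (n - L) = sum ?q {n - L..<n} + ?q n"
  proof (cases "n \<ge> L")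
    case True
    then show ?thesis
      using sum.atLeast_Suc_lessThan[of "n - L" "Suc n" ?q] by (simp add: Suc_diff_le)
  qed simp
  moreover have "?q n = max (S n) (inv_pos L x\<^sub>1 S d n) - inv_pos L x\<^sub>1 S d n"
    using assms by (subst order_qty.simps) (simp add: max_def)
  ultimately show ?thesis
    using inv_level_Suc[OF assms, of L x\<^sub>1 S d]
    by (simp add: inv_pos.simps[of L x\<^sub>1 S d] del: sum.op_ivl_Suc)
qed

text \<open>The orders arriving in the \<open>L\<close> periods from \<open>n\<close> on are exactly
  those outstanding at \<open>n\<close>; later orders arrive too late to matter.\<close>

lemma inv_level_lead_time:
  assumes "n \<ge> 1"
  shows "inv_level L x\<^sub>1 S d (n + L) = inv_pos L x\<^sub>1 S d n - (\<Sum>j\<in>{n..<n + L}. d j)"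
proof -
  let ?q = "order_qty L x\<^sub>1 S d"
  have "inv_level L x\<^sub>1 S d (n + j)
      = inv_level L x\<^sub>1 S d n + sum ?q {n - L..<n + j - L} - sum d {n..<n + j}" for j
  proof (induction j)
    case (Suc j)
    have "sum ?q {n - L..<n + Suc j - L} = sum ?q {n - L..<n + j - L} + ?q (n + j - L)"
    proof (cases "n + j \<ge> L")
      case True
      then show ?thesis
        by (simp add: Suc_diff_le)
    qed simp
    then show ?case
      using Suc.IH inv_level_Suc[of "n + j" L x\<^sub>1 S d] assms by simp
  qed simp
  from this[of L] show ?thesis
    by (simp add: inv_pos.simps)
qed

lemma stock_level_eq:
  assumes "n \<ge> 1"
  shows "stock_level L x\<^sub>1 S d (n + L)
    = max (S n) (inv_pos L x\<^sub>1 S d n) - (\<Sum>j\<in>{n..<n + L}. d j)"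
  using assms inv_level_lead_time[OF assms, of L x\<^sub>1 S d]
  by (simp add: stock_level.simps order_qty.simps[of L x\<^sub>1 S d n] max_def)

text \<open>The closed-form maximum in threshold form. The induction varies \<open>a\<close>, since
  each step moves the demand \<open>d n\<close> over to it; \<open>x\<^sub>1 \<le> S 1\<close>
  removes the initial level from the maximum in period 1.\<close>

lemma less_max_inv_pos_iff:
  assumes "n \<ge> 1" and "x\<^sub>1 \<le> S 1"
  shows "a < max (S n) (inv_pos L x\<^sub>1 S d n)
    \<longleftrightarrow> (\<exists>k\<in>{1..n}. a + (\<Sum>j\<in>{k..<n}. d j) < S k)"
  using assms(1)
proof (induction n arbitrary: a rule: dec_induct)
  case base
  then show ?case
    using assms(2) by (simp add: inv_pos_1[unfolded One_nat_def] max_def)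
next
  case (step n)
  have "a < max (S (Suc n)) (inv_pos L x\<^sub>1 S d (Suc n))
      \<longleftrightarrow> a < S (Suc n) \<or> a + d n < max (S n) (inv_pos L x\<^sub>1 S d n)"
    using step.hyps by (auto simp: inv_pos_Suc less_max_iff_disj)
  also have "\<dots> \<longleftrightarrow> a < S (Suc n) \<or> (\<exists>k\<in>{1..n}. a + (\<Sum>j\<in>{k..<Suc n}. d j) < S k)"
    unfolding step.IH by (auto simp: algebra_simps)
  also have "\<dots> \<longleftrightarrow> (\<exists>k\<in>{1..Suc n}. a + (\<Sum>j\<in>{k..<Suc n}. d j) < S k)"
    by (simp add: atLeastAtMostSuc_conv del: sum.op_ivl_Suc)
  finally show ?case .
qed

lemma less_stock_level_iff:
  assumes "n \<ge> 1" and "x\<^sub>1 \<le> S 1"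
  shows "a < stock_level L x\<^sub>1 S d (n + L)
    \<longleftrightarrow> (\<exists>k\<in>{1..n}. a + (\<Sum>j\<in>{n..<n + L}. d j) + (\<Sum>j\<in>{k..<n}. d j) < S k)"
  using less_max_inv_pos_iff[of n x\<^sub>1 S "a + (\<Sum>j\<in>{n..<n + L}. d j)" L d] assms
  by (simp add: stock_level_eq less_diff_eq)

text \<open>Dividing by \<delta> and rounding down sends separated points to distinct integers in
  \<open>{0..\<lfloor>B / \<delta>\<rfloor>}\<close>.\<close>

lemma card_le_separated:
  fixes f :: "'a \<Rightarrow> real"
  assumes "finite I" and "\<delta> > 0"
    and range: "\<And>i. i \<in> I \<Longrightarrow> 0 \<le> f i \<and> f i \<le> B"
    and sep: "\<And>i j. i \<in> I \<Longrightarrow> j \<in> I \<Longrightarrow> i \<noteq> j \<Longrightarrow> \<bar>f i - f j\<bar> \<ge> \<delta>"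
  shows "real (card I) \<le> max 0 (B / \<delta>) + 1"
proof -
  let ?g = "\<lambda>i. \<lfloor>f i / \<delta>\<rfloor>"
  have "inj_on ?g I"
  proof (rule inj_onI, rule ccontr)
    fix i j
    assume ij: "i \<in> I" "j \<in> I" "?g i = ?g j" "i \<noteq> j"
    then have "\<bar>f i / \<delta> - f j / \<delta>\<bar> < 1"
      by linarith
    then have "\<bar>f i - f j\<bar> < \<delta>"
      using \<open>\<delta> > 0\<close> by (simp add: diff_divide_distrib[symmetric] abs_divide)
    then show False
      using sep[of i j] ij by simp
  qed
  moreover have "?g ` I \<subseteq> {0..\<lfloor>B / \<delta>\<rfloor>}"
    using range \<open>\<delta> > 0\<close> by (auto intro!: floor_mono divide_right_mono)
  ultimately have "card I \<le> card {0..\<lfloor>B / \<delta>\<rfloor>}"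
    by (metis card_image card_mono finite_atLeastAtMost_int)
  then show ?thesis
    by simp linarith
qed

lemma gamma_shattered_stock_class_bound:
  fixes x\<^sub>1 U H \<gamma> :: real and x :: "nat \<Rightarrow> nat \<Rightarrow> real"
  assumes "U > 0" and "0 < \<gamma>" and "x\<^sub>1 \<le> 0" and H: "H = (real L + 1) * U" and "n \<ge> 1"
    and nonneg: "\<And>i j. i \<in> {1..m} \<Longrightarrow> j \<in> {1..<n} \<Longrightarrow> 0 \<le> x i j"
    and shat: "gamma_shattered \<gamma> (stock_class L x\<^sub>1 U H (n + L)) m x"
  shows "real m \<le> 1 / (2 * \<gamma>) + 1"
proof -
  have "H > 0"
    using assms by simp
  obtain \<tau> where \<tau>: "\<And>A. A \<subseteq> {1..m} \<Longrightarrow> \<exists>f \<in> stock_class L x\<^sub>1 U H (n + L).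
      (\<forall>i\<in>A. f (x i) > \<tau> i + \<gamma>) \<and> (\<forall>i\<in>{1..m} - A. f (x i) \<le> \<tau> i - \<gamma>)"
    using shat unfolding gamma_shattered_def by blast
  define \<phi> where
    "\<phi> i k = H * \<tau> i + (\<Sum>j\<in>{n..<n + L}. x i j) + (\<Sum>j\<in>{k..<n}. x i j)" for i k
  have \<phi>_antimono: "\<phi> i l \<le> \<phi> i k" if "i \<in> {1..m}" "1 \<le> k" "k \<le> l" for i k l
    unfolding \<phi>_def using that nonneg by (intro add_left_mono sum_mono2) auto
  \<comment> \<open>A maximum exceeds its threshold iff some period's term does, and stays below iff
    all do. Multiplying by \<open>H\<close> undoes the normalization.\<close>
  have select: "\<exists>S \<in> {1..n} \<rightarrow> {0..H}.
      (\<forall>i\<in>A. \<exists>k\<in>{1..n}. \<phi> i k + \<gamma> * H < S k) \<and>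
      (\<forall>i\<in>{1..m} - A. \<forall>k\<in>{1..n}. S k \<le> \<phi> i k - \<gamma> * H)" if A: "A \<subseteq> {1..m}" for A
  proof -
    obtain S where S: "S \<in> {1..n} \<rightarrow>\<^sub>E {0..H}"
      and hi: "\<And>i. i \<in> A \<Longrightarrow> stock_level L x\<^sub>1 S (x i) (n + L) / H > \<tau> i + \<gamma>"
      and lo: "\<And>i. i \<in> {1..m} - A \<Longrightarrow> stock_level L x\<^sub>1 S (x i) (n + L) / H \<le> \<tau> i - \<gamma>"
      using \<tau>[OF A] unfolding stock_class_def H[symmetric] by auto
    have "x\<^sub>1 \<le> S 1"
      using PiE_mem[OF S, of 1] assms by simp
    note iff = less_stock_level_iff[OF \<open>n \<ge> 1\<close>, of x\<^sub>1 S, OF this]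
    have "\<exists>k\<in>{1..n}. \<phi> i k + \<gamma> * H < S k" if "i \<in> A" for i
    proof -
      have "H * \<tau> i + \<gamma> * H < stock_level L x\<^sub>1 S (x i) (n + L)"
        using hi[OF that] \<open>H > 0\<close> by (simp add: field_simps)
      then show ?thesis
        unfolding iff \<phi>_def by (simp add: algebra_simps)
    qed
    moreover have "S k \<le> \<phi> i k - \<gamma> * H" if "i \<in> {1..m} - A" "k \<in> {1..n}" for i k
    proof -
      have "\<not> H * \<tau> i - \<gamma> * H < stock_level L x\<^sub>1 S (x i) (n + L)"
        using lo[OF that(1)] \<open>H > 0\<close> by (simp add: field_simps)
      then show ?thesis
        using that(2) unfolding iff \<phi>_def by (auto simp: not_less algebra_simps)
    qed
    ultimately show ?thesis
      using S by blast
  qed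
  \<comment> \<open>Take \<open>A = {}\<close>: even a policy below every threshold has
    \<open>S k \<ge> 0\<close>.\<close>
  have \<phi>_nonneg: "0 \<le> \<phi> i k" if i: "i \<in> {1..m}" and k: "k \<in> {1..n}" for i k
  proof -
    obtain S where "S \<in> {1..n} \<rightarrow> {0..H}" "\<forall>k\<in>{1..n}. S k \<le> \<phi> i k - \<gamma> * H"
      using select[of "{}"] i by auto
    then have "0 \<le> S k" "S k \<le> \<phi> i k - \<gamma> * H"
      using k by (auto simp: Pi_iff)
    moreover have "0 < \<gamma> * H"
      using \<open>0 < \<gamma>\<close> \<open>H > 0\<close> by simp
    ultimately show ?thesis
      by linarith
  qed
  \<comment> \<open>Take \<open>A = {i}\<close>: at the witness period \<open>k\<close>, the level
    \<open>S k \<le> H\<close> lies at least \<open>\<gamma> * H\<close> above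
    \<open>\<phi> i k\<close> and at least as far below every other
    \<open>\<phi> j k\<close>.\<close>
  have "\<exists>k\<in>{1..n}. \<phi> i k \<le> H \<and> (\<forall>j\<in>{1..m} - {i}. \<phi> i k + 2 * \<gamma> * H \<le> \<phi> j k)"
    if i: "i \<in> {1..m}" for i
  proof -
    obtain S k where S: "S \<in> {1..n} \<rightarrow> {0..H}" and k: "k \<in> {1..n}"
      and hi: "\<phi> i k + \<gamma> * H < S k"
      and lo: "\<And>j. j \<in> {1..m} - {i} \<Longrightarrow> S k \<le> \<phi> j k - \<gamma> * H"
      using select[of "{i}"] i by auto
    have "S k \<le> H" "0 < \<gamma> * H"
      using S k \<open>0 < \<gamma>\<close> \<open>H > 0\<close> by (auto simp: Pi_iff)
    then show ?thesis
      using k hi lo by (intro bexI[of _ k]) (fastforce)+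
  qed
  then obtain \<kappa> where \<kappa>: "\<And>i. i \<in> {1..m} \<Longrightarrow> \<kappa> i \<in> {1..n} \<and> \<phi> i (\<kappa> i) \<le> H \<and>
      (\<forall>j\<in>{1..m} - {i}. \<phi> i (\<kappa> i) + 2 * \<gamma> * H \<le> \<phi> j (\<kappa> i))"
    by metis
  \<comment> \<open>Of two sequences, the one with the earlier witness period has the larger value.
    Either order of the periods is possible, so one case suffices for separation by
    symmetry.\<close>
  have gap: "\<phi> i (\<kappa> i) + 2 * \<gamma> * H \<le> \<phi> j (\<kappa> j)"
    if "i \<in> {1..m}" "j \<in> {1..m}" "i \<noteq> j" "\<kappa> j \<le> \<kappa> i" for i j
  proof -
    have "\<phi> i (\<kappa> i) + 2 * \<gamma> * H \<le> \<phi> j (\<kappa> i)"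
      using \<kappa>[of i] that by auto
    also have "\<dots> \<le> \<phi> j (\<kappa> j)"
      using \<kappa>[of j] that by (intro \<phi>_antimono) auto
    finally show ?thesis .
  qed
  have "real (card {1..m}) \<le> max 0 (H / (2 * \<gamma> * H)) + 1"
  proof (rule card_le_separated)
    show "0 \<le> \<phi> i (\<kappa> i) \<and> \<phi> i (\<kappa> i) \<le> H" if "i \<in> {1..m}" for i
      using that \<kappa> \<phi>_nonneg by blast
    show "\<bar>\<phi> i (\<kappa> i) - \<phi> j (\<kappa> j)\<bar> \<ge> 2 * \<gamma> * H"
      if "i \<in> {1..m}" "j \<in> {1..m}" "i \<noteq> j" for i j
      using gap[of i j] gap[of j i] that by linarith
  qed (use \<open>0 < \<gamma>\<close> \<open>H > 0\<close> in auto)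
  then show ?thesis
    using \<open>0 < \<gamma>\<close> \<open>H > 0\<close> by simp
qed

text \<open>Sizes are integers, so a real bound \<open>c\<close> on them gives the bound
  \<open>\<lfloor>c\<rfloor>\<close> on their supremum in \<open>enat\<close>, which also rules out
  \<infinity>.\<close>

lemma pseudo_gamma_dim_le:
  assumes "\<And>m x. (\<forall>i\<in>{1..m}. x i \<in> X) \<Longrightarrow> gamma_shattered \<gamma> F m x \<Longrightarrow> real m \<le> c"
    and "0 \<le> c"
  shows "ereal_of_enat (pseudo_gamma_dim \<gamma> X F) \<le> ereal c"
proof -
  have "pseudo_gamma_dim \<gamma> X F \<le> enat (nat \<lfloor>c\<rfloor>)"
    unfolding pseudo_gamma_dim_def using assms(1)
    by (intro Sup_least) (auto simp: le_nat_floor)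
  then have "ereal_of_enat (pseudo_gamma_dim \<gamma> X F) \<le> ereal_of_enat (enat (nat \<lfloor>c\<rfloor>))"
    by (simp only: ereal_of_enat_le_iff)
  also have "\<dots> \<le> ereal c"
    using \<open>0 \<le> c\<close> by simp
  finally show ?thesis .
qed

theorem theorem4:
  fixes K b h U H x\<^sub>1 \<gamma> :: real and L T t :: nat
  assumes "K = 0"
    and "b \<in> {0..1}" and "h \<in> {0..1}"
    and "U > 0" and "T > 0"
    and "0 < \<gamma>" and "\<gamma> \<le> 1"
    and "x\<^sub>1 \<le> 0"
    and "H = (real L + 1) * U"
    and "t \<in> {L + 1..T + L}"
  shows "ereal_of_enat (pseudo_gamma_dim \<gamma> ({1..T + L} \<rightarrow>\<^sub>E {0..U}) (stock_class L x\<^sub>1 U H t))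
           \<le> ereal (2 / \<gamma> + 1)"
proof (rule pseudo_gamma_dim_le)
  fix m :: nat and x :: "nat \<Rightarrow> nat \<Rightarrow> real"
  assume x: "\<forall>i\<in>{1..m}. x i \<in> {1..T + L} \<rightarrow>\<^sub>E {0..U}"
    and "gamma_shattered \<gamma> (stock_class L x\<^sub>1 U H t) m x"
  moreover define n where "n = t - L"
  then have t: "t = n + L" and n: "n \<ge> 1" "n \<le> T"
    using assms(10) by auto
  \<comment> \<open>Periods before \<open>n \<le> T\<close> lie within the horizon, where demands
    are in \<open>{0..U}\<close>.\<close>
  moreover have "0 \<le> x i j" if "i \<in> {1..m}" "j \<in> {1..<n}" for i j
    using PiE_mem[OF x[rule_format, OF that(1)], of j] that(2) n by simp
  ultimately have "real m \<le> 1 / (2 * \<gamma>) + 1"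
    using assms by (intro gamma_shattered_stock_class_bound[of U \<gamma> x\<^sub>1 H L n m x]) auto
  also have "\<dots> \<le> 2 / \<gamma> + 1"
    using \<open>0 < \<gamma>\<close> by (simp add: field_simps)
  finally show "real m \<le> 2 / \<gamma> + 1" .
qed (use \<open>0 < \<gamma>\<close> in simp)

end
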